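(* Let $(\Omega,\mathcal{A},\mu)$ be a $\sigma$-finite measure space with $\mu(\Omega)=\infty$ satisfying the following condition: there is a countable family $\mathcal{A}_1\subset\mathcal{A}$ such that, for every $M\in\mathcal{A}$ with $\mu(M)<\infty$ and every $\varepsilon>0$, there exists $M_0\in\mathcal{A}_1$ with $\mu(M\,\Delta\,M_0)<\varepsilon$. Then $\mathcal{S}_u\setminus\bigcup_{q>0}\mathcal{S}_{L_q}$ is $\mathfrak{c}$-dense-lineable in $L_0^{\mathbb{N}}$. In particular, the sets $\mathcal{S}_p\setminus\bigcup_{q>0}\mathcal{S}_{L_q}$, $\mathcal{S}_m\setminus\bigcup_{q>0}\mathcal{S}_{L_q}$ and $\mathcal{S}_{au}\setminus\bigcup_{q>0}\mathcal{S}_{L_q}$ are $\mathfrak{c}$-dense-lineable in $L_0^{\mathbb{N}}$.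
   Context: $(\Omega,\mathcal{A},\mu)$ is a positive measure space; $A\,\Delta\,B=(A\setminus B)\cup(B\setminus A)$. It is $\sigma$-finite if $\Omega$ is a countable union of measurable sets of finite measure. $L_0$ is the real vector space of ($\mu$-a.e. equality classes of) measurable functions $f:\Omega\to\mathbb{R}$, with the topology of local convergence in measure, i.e. the vector topology with a base of $0$-neighborhoods given by the sets $\{f\in L_0:\int_K\min\{1,|f|\}\,d\mu<\varepsilon\}$, $\varepsilon>0$, $K\in\mathcal{A}$, $\mu(K)<\infty$. $L_0^{\mathbb{N}}$ is the vector space of all sequences $(f_n)_{n\in\mathbb{N}}$ in $L_0$, with the product topology. Subsets of $L_0^{\mathbb{N}}$: $\mathcal{S}_p$: sequences with $f_n\to0$ pointwise almost everywhere. $\mathcal{S}_u$: $f_n\to0$ uniformly almost everywhere (there is $Z\in\mathcal{A}$ with $\mu(Z)=0$ and $f_n\to0$ uniformly on $\Omega\setminus Z$). $\mathcal{S}_{au}$: $f_n\to0$ almost uniformly (for every $\varepsilon>0$ there is $Z_\varepsilon\in\mathcal{A}$ with $\mu(Z_\varepsilon)<\varepsilon$ and $f_n\to0$ uniformly on $\Omega\setminus Z_\varepsilon$). $\mathcal{S}_m$: $f_n\to0$ in measure ($\lim_n\mu(\{|f_n|>\varepsilon\})=0$ for every $\varepsilon>0$). $\mathcal{S}_{L_q}$ ($q\in(0,+\infty)$): $\lim_n\int_\Omega|f_n|^q\,d\mu=0$. $\mathfrak{c}$ is the cardinality of the continuum. A subset $A$ of a topological vector space $X$ is $\mathfrak{c}$-dense-lineable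 in $X$ if there is a dense vector subspace $V\subset X$ with $\dim(V)=\mathfrak{c}$ and $V\setminus\{0\}\subset A$. *)

theory Defs
  imports
    "Jordan_Normal_Form.Missing_VectorSpace"
    "HOL-Algebra.Algebraic_Closure_Type"
    "HOL-Analysis.Analysis"
begin

section \<open>The space \<open>L\<^sub>0\<close> and its sequence space\<close>

text \<open>
  The elements of \<open>L\<^sub>0\<close> are genuine almost-everywhere equality classes, that is, sets of
  measurable functions. Since the measure is a term, \<open>L\<^sub>0\<close> is a carrier set, and its vector
  space structure is a module record over the field of reals.
\<close>

abbreviation real_field :: "real ring" where
  "real_field \<equiv> ring_of_type_algebra"

definition ae_eq :: "'a measure \<Rightarrow> (('a \<Rightarrow> real) \<times> ('a \<Rightarrow> real)) set" where
  "ae_eq M = {(f, g). f \<in> borel_measurable M \<and> g \<in> borel_measurable M \<and> (AE x in M. f x = g x)}"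

definition ae_class :: "'a measure \<Rightarrow> ('a \<Rightarrow> real) \<Rightarrow> ('a \<Rightarrow> real) set" where
  "ae_class M f = ae_eq M `` {f}"

text \<open>
  The components \<^term>\<open>monoid.mult\<close> and \<^term>\<open>monoid.one\<close> of a module record play no role
  for vector spaces.
\<close>

definition L0 :: "'a measure \<Rightarrow> (real, ('a \<Rightarrow> real) set) module" where
  "L0 M = \<lparr>
     carrier = borel_measurable M // ae_eq M,
     monoid.mult = undefined,
     one = undefined,
     ring.zero = ae_class M (\<lambda>x. 0),
     add = (\<lambda>F G. \<Union>f\<in>F. \<Union>g\<in>G. ae_class M (\<lambda>x. f x + g x)),
     module.smult = (\<lambda>c F. \<Union>f\<in>F. ae_class M (\<lambda>x. c * f x))\<rparr>"

definition L0_seq :: "'a measure \<Rightarrow> (real, nat \<Rightarrow> ('a \<Rightarrow> real) set) module" where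
  "L0_seq M = \<lparr>
     carrier = UNIV \<rightarrow> carrier (L0 M),
     monoid.mult = undefined,
     one = undefined,
     ring.zero = (\<lambda>n. \<zero>\<^bsub>L0 M\<^esub>),
     add = (\<lambda>F G n. F n \<oplus>\<^bsub>L0 M\<^esub> G n),
     module.smult = (\<lambda>c F n. c \<odot>\<^bsub>L0 M\<^esub> F n)\<rparr>"


section \<open>Local convergence in measure\<close>

definition L0_nhd :: "'a measure \<Rightarrow> 'a set \<Rightarrow> real \<Rightarrow> ('a \<Rightarrow> real) set set" where
  "L0_nhd M K \<epsilon> =
     ae_class M ` {f \<in> borel_measurable M. (\<integral>\<^sup>+x\<in>K. ennreal (min 1 \<bar>f x\<bar>) \<partial>M) < ennreal \<epsilon>}"

definition L0_open :: "'a measure \<Rightarrow> ('a \<Rightarrow> real) set set \<Rightarrow> bool" where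
  "L0_open M U \<longleftrightarrow> U \<subseteq> carrier (L0 M) \<and>
     (\<forall>F\<in>U. \<exists>K \<epsilon>. K \<in> sets M \<and> emeasure M K < \<infinity> \<and> \<epsilon> > 0 \<and>
        (\<forall>H\<in>L0_nhd M K \<epsilon>. F \<oplus>\<^bsub>L0 M\<^esub> H \<in> U))"

definition L0_topology :: "'a measure \<Rightarrow> ('a \<Rightarrow> real) set topology" where
  "L0_topology M = topology (L0_open M)"

definition L0_seq_topology :: "'a measure \<Rightarrow> (nat \<Rightarrow> ('a \<Rightarrow> real) set) topology" where
  "L0_seq_topology M = product_topology (\<lambda>n. L0_topology M) UNIV"


section \<open>Sets of null sequences\<close>

definition ae_classes ::
  "'a measure \<Rightarrow> ((nat \<Rightarrow> 'a \<Rightarrow> real) \<Rightarrow> bool) \<Rightarrow> (nat \<Rightarrow> ('a \<Rightarrow> real) set) set" where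
  "ae_classes M P = {(\<lambda>n. ae_class M (f n)) | f. (\<forall>n. f n \<in> borel_measurable M) \<and> P f}"

definition S_p :: "'a measure \<Rightarrow> (nat \<Rightarrow> ('a \<Rightarrow> real) set) set" where
  "S_p M = ae_classes M (\<lambda>f. AE x in M. (\<lambda>n. f n x) \<longlonglongrightarrow> 0)"

definition S_u :: "'a measure \<Rightarrow> (nat \<Rightarrow> ('a \<Rightarrow> real) set) set" where
  "S_u M = ae_classes M (\<lambda>f. \<exists>Z\<in>sets M. emeasure M Z = 0 \<and>
     uniform_limit (space M - Z) f (\<lambda>x. 0) sequentially)"

definition S_au :: "'a measure \<Rightarrow> (nat \<Rightarrow> ('a \<Rightarrow> real) set) set" where
  "S_au M = ae_classes M (\<lambda>f. \<forall>\<epsilon>>0::real. \<exists>Z\<in>sets M. emeasure M Z < ennreal \<epsilon> \<and>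
     uniform_limit (space M - Z) f (\<lambda>x. 0) sequentially)"

definition S_m :: "'a measure \<Rightarrow> (nat \<Rightarrow> ('a \<Rightarrow> real) set) set" where
  "S_m M = ae_classes M (\<lambda>f. \<forall>\<epsilon>>0::real.
     (\<lambda>n. emeasure M {x \<in> space M. \<bar>f n x\<bar> > \<epsilon>}) \<longlonglongrightarrow> 0)"

definition S_L :: "'a measure \<Rightarrow> real \<Rightarrow> (nat \<Rightarrow> ('a \<Rightarrow> real) set) set" where
  "S_L M q = ae_classes M (\<lambda>f. (\<lambda>n. \<integral>\<^sup>+x. ennreal (\<bar>f n x\<bar> powr q) \<partial>M) \<longlonglongrightarrow> 0)"


section \<open>Lineability\<close>

text \<open>\<open>T\<close> is the topology of the vector space \<open>E\<close>; \<open>B\<close> is a Hamel basis of \<open>V\<close>.\<close>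

definition continuum_dense_lineable ::
  "(real, 'v, 'm) module_scheme \<Rightarrow> 'v topology \<Rightarrow> 'v set \<Rightarrow> bool" where
  "continuum_dense_lineable E T A \<longleftrightarrow>
     (\<exists>V. VectorSpace.subspace real_field V E \<and>
          T closure_of V = topspace T \<and>
          (\<exists>B. vectorspace.basis real_field (E\<lparr>carrier := V\<rparr>) B \<and> B \<approx> (UNIV :: real set)) \<and>
          V - {\<zero>\<^bsub>E\<^esub>} \<subseteq> A)"


section \<open>Well-definedness\<close>

lemma equiv_ae_eq: "equiv (borel_measurable M) (ae_eq M)"
proof (intro equivI)
  show "ae_eq M \<subseteq> borel_measurable M \<times> borel_measurable M"
    by (auto simp: ae_eq_def)
  show "refl_on (borel_measurable M) (ae_eq M)"
    by (auto simp: refl_on_def ae_eq_def)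
  show "sym (ae_eq M)"
    by (auto simp: sym_def ae_eq_def eq_commute)
  show "trans (ae_eq M)"
  proof (rule transI)
    fix f g h assume "(f, g) \<in> ae_eq M" "(g, h) \<in> ae_eq M"
    moreover from this have "AE x in M. f x = g x" "AE x in M. g x = h x"
      by (auto simp: ae_eq_def)
    then have "AE x in M. f x = h x"
      by eventually_elim simp
    ultimately show "(f, h) \<in> ae_eq M"
      by (simp add: ae_eq_def)
  qed
qed

lemma ae_class_eq_iff:
  assumes "f \<in> borel_measurable M" "g \<in> borel_measurable M"
  shows "ae_class M f = ae_class M g \<longleftrightarrow> (AE x in M. f x = g x)"
  using eq_equiv_class_iff[OF equiv_ae_eq assms] assms by (simp add: ae_class_def ae_eq_def)

lemma mem_ae_class:
  "g \<in> ae_class M f \<longleftrightarrow>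
     f \<in> borel_measurable M \<and> g \<in> borel_measurable M \<and> (AE x in M. f x = g x)"
  by (simp add: ae_class_def ae_eq_def)

lemma carrier_L0: "carrier (L0 M) = ae_class M ` borel_measurable M"
  by (auto simp: L0_def quotient_def ae_class_def)

lemma add_L0:
  assumes "f \<in> borel_measurable M" "g \<in> borel_measurable M"
  shows "ae_class M f \<oplus>\<^bsub>L0 M\<^esub> ae_class M g = ae_class M (\<lambda>x. f x + g x)"
proof -
  have "ae_class M (\<lambda>x. f' x + g' x) = ae_class M (\<lambda>x. f x + g x)"
    if "f' \<in> ae_class M f" "g' \<in> ae_class M g" for f' g'
  proof -
    have "AE x in M. f x = f' x" "AE x in M. g x = g' x"
      using that by (simp_all add: mem_ae_class)
    then have "AE x in M. f' x + g' x = f x + g x"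
      by eventually_elim simp
    then show ?thesis
      using that by (subst ae_class_eq_iff) (auto simp: mem_ae_class)
  qed
  moreover have "f \<in> ae_class M f" "g \<in> ae_class M g"
    using assms by (auto simp: mem_ae_class)
  ultimately have "(\<Union>f'\<in>ae_class M f. \<Union>g'\<in>ae_class M g. ae_class M (\<lambda>x. f' x + g' x)) =
      ae_class M (\<lambda>x. f x + g x)"
    by (intro UN_constant_eq ballI) assumption+
  then show ?thesis
    by (simp add: L0_def)
qed

lemma smult_L0:
  assumes "f \<in> borel_measurable M"
  shows "c \<odot>\<^bsub>L0 M\<^esub> ae_class M f = ae_class M (\<lambda>x. c * f x)"
proof -
  have "ae_class M (\<lambda>x. c * f' x) = ae_class M (\<lambda>x. c * f x)" if "f' \<in> ae_class M f" for f'
  proof -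
    have "AE x in M. f x = f' x"
      using that by (simp add: mem_ae_class)
    then have "AE x in M. c * f' x = c * f x"
      by eventually_elim simp
    then show ?thesis
      using that by (subst ae_class_eq_iff) (auto simp: mem_ae_class)
  qed
  moreover have "f \<in> ae_class M f"
    using assms by (auto simp: mem_ae_class)
  ultimately have "(\<Union>f'\<in>ae_class M f. ae_class M (\<lambda>x. c * f' x)) = ae_class M (\<lambda>x. c * f x)"
    by (intro UN_constant_eq ballI) assumption+
  then show ?thesis
    by (simp add: L0_def)
qed

lemma zero_L0: "\<zero>\<^bsub>L0 M\<^esub> = ae_class M (\<lambda>x. 0)"
  by (simp add: L0_def)

lemma abelian_group_L0: "abelian_group (L0 M)"
proof (rule abelian_groupI)
  fix F assume "F \<in> carrier (L0 M)"
  then obtain f where f: "f \<in> borel_measurable M" "F = ae_class M f"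
    by (auto simp: carrier_L0)
  then have "ae_class M (\<lambda>x. - f x) \<oplus>\<^bsub>L0 M\<^esub> F = \<zero>\<^bsub>L0 M\<^esub>"
    by (simp add: add_L0 zero_L0)
  then show "\<exists>G\<in>carrier (L0 M). G \<oplus>\<^bsub>L0 M\<^esub> F = \<zero>\<^bsub>L0 M\<^esub>"
    using f by (auto simp: carrier_L0)
qed (auto simp: carrier_L0 add_L0 zero_L0 add_ac)

lemma vectorspace_L0: "vectorspace real_field (L0 M)"
proof (intro vectorspace.intro Module.moduleI)
  show "cring real_field" "Ring.field real_field"
    by (rule cring_from_type_algebra field_from_type_algebra)+
qed (auto simp: abelian_group_L0 carrier_L0 add_L0 smult_L0 ring_of_type_algebra_def algebra_simps)

lemma vectorspace_L0_seq: "vectorspace real_field (L0_seq M)"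
proof -
  interpret L: vectorspace real_field "L0 M" by (rule vectorspace_L0)
  have "abelian_group (L0_seq M)"
  proof (rule abelian_groupI)
    fix F assume F: "F \<in> carrier (L0_seq M)"
    show "\<exists>G\<in>carrier (L0_seq M). G \<oplus>\<^bsub>L0_seq M\<^esub> F = \<zero>\<^bsub>L0_seq M\<^esub>"
      using F by (intro bexI[of _ "\<lambda>n. \<ominus>\<^bsub>L0 M\<^esub> F n"])
        (auto simp: L0_seq_def Pi_iff L.M.l_neg)
  qed (auto simp: L0_seq_def fun_eq_iff L.M.a_ac Pi_iff)
  then show ?thesis
    by (intro vectorspace.intro Module.moduleI L.R.is_cring L.field_axioms)
      (auto simp: L0_seq_def fun_eq_iff Pi_iff L.smult_l_distr L.smult_r_distr L.smult_assoc1)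
qed

lemma L0_nhd_mono:
  assumes "K \<subseteq> K'" "\<epsilon>' \<le> \<epsilon>"
  shows "L0_nhd M K' \<epsilon>' \<subseteq> L0_nhd M K \<epsilon>"
proof -
  have "(\<integral>\<^sup>+x\<in>K. ennreal (min 1 \<bar>f x\<bar>) \<partial>M) < ennreal \<epsilon>"
    if "(\<integral>\<^sup>+x\<in>K'. ennreal (min 1 \<bar>f x\<bar>) \<partial>M) < ennreal \<epsilon>'" for f
  proof -
    have "(\<integral>\<^sup>+x\<in>K. ennreal (min 1 \<bar>f x\<bar>) \<partial>M) \<le> (\<integral>\<^sup>+x\<in>K'. ennreal (min 1 \<bar>f x\<bar>) \<partial>M)"
      using assms(1) by (intro nn_integral_mono) (auto split: split_indicator)
    also note that
    also have "ennreal \<epsilon>' \<le> ennreal \<epsilon>"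
      using assms(2) by (rule ennreal_leI)
    finally show ?thesis .
  qed
  then show ?thesis
    unfolding L0_nhd_def by (intro image_mono) auto
qed

lemma istopology_L0_open: "istopology (L0_open M)"
  unfolding istopology_def
proof (intro conjI allI impI)
  fix U U' assume U: "L0_open M U" and U': "L0_open M U'"
  show "L0_open M (U \<inter> U')"
    unfolding L0_open_def
  proof (intro conjI ballI)
    show "U \<inter> U' \<subseteq> carrier (L0 M)"
      using U by (auto simp: L0_open_def)
    fix F assume F: "F \<in> U \<inter> U'"
    obtain K \<epsilon> where K: "K \<in> sets M" "emeasure M K < \<infinity>" "\<epsilon> > 0"
      "\<forall>H\<in>L0_nhd M K \<epsilon>. F \<oplus>\<^bsub>L0 M\<^esub> H \<in> U"
      using U F unfolding L0_open_def by blast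
    obtain K' \<epsilon>' where K': "K' \<in> sets M" "emeasure M K' < \<infinity>" "\<epsilon>' > 0"
      "\<forall>H\<in>L0_nhd M K' \<epsilon>'. F \<oplus>\<^bsub>L0 M\<^esub> H \<in> U'"
      using U' F unfolding L0_open_def by blast
    have "emeasure M (K \<union> K') < \<infinity>"
      by (rule le_less_trans[OF emeasure_subadditive]) (use K K' in auto)
    moreover have "\<forall>H\<in>L0_nhd M (K \<union> K') (min \<epsilon> \<epsilon>'). F \<oplus>\<^bsub>L0 M\<^esub> H \<in> U \<inter> U'"
    proof
      fix H assume "H \<in> L0_nhd M (K \<union> K') (min \<epsilon> \<epsilon>')"
      then have "H \<in> L0_nhd M K \<epsilon>" "H \<in> L0_nhd M K' \<epsilon>'"
        using L0_nhd_mono[of K "K \<union> K'" "min \<epsilon> \<epsilon>'" \<epsilon>] L0_nhd_mono[of K' "K \<union> K'" "min \<epsilon> \<epsilon>'" \<epsilon>']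
        by auto
      then show "F \<oplus>\<^bsub>L0 M\<^esub> H \<in> U \<inter> U'"
        using K(4) K'(4) by simp
    qed
    moreover have "K \<union> K' \<in> sets M" "min \<epsilon> \<epsilon>' > 0"
      using K K' by auto
    ultimately show "\<exists>K \<epsilon>. K \<in> sets M \<and> emeasure M K < \<infinity> \<and> \<epsilon> > 0 \<and>
        (\<forall>H\<in>L0_nhd M K \<epsilon>. F \<oplus>\<^bsub>L0 M\<^esub> H \<in> U \<inter> U')"
      by blast
  qed
next
  fix \<U> assume \<U>: "\<forall>U\<in>\<U>. L0_open M U"
  show "L0_open M (\<Union>\<U>)"
    unfolding L0_open_def
  proof (intro conjI ballI)
    show "\<Union>\<U> \<subseteq> carrier (L0 M)"
      using \<U> by (auto simp: L0_open_def)
    fix F assume "F \<in> \<Union>\<U>"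
    then obtain U where U: "U \<in> \<U>" "F \<in> U"
      by blast
    then obtain K \<epsilon> where "K \<in> sets M" "emeasure M K < \<infinity>" "\<epsilon> > 0"
      "\<forall>H\<in>L0_nhd M K \<epsilon>. F \<oplus>\<^bsub>L0 M\<^esub> H \<in> U"
      using \<U> unfolding L0_open_def by blast
    with U show "\<exists>K \<epsilon>. K \<in> sets M \<and> emeasure M K < \<infinity> \<and> \<epsilon> > 0 \<and>
        (\<forall>H\<in>L0_nhd M K \<epsilon>. F \<oplus>\<^bsub>L0 M\<^esub> H \<in> \<Union>\<U>)"
      by blast
  qed
qed

lemma openin_L0_topology: "openin (L0_topology M) = L0_open M"
  by (simp add: L0_topology_def istopology_L0_open)

lemma topspace_L0_topology: "topspace (L0_topology M) = carrier (L0 M)"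
proof -
  have "L0_open M (carrier (L0 M))"
    unfolding L0_open_def
    by (intro conjI ballI subset_refl exI[of _ "{}"] exI[of _ 1])
      (auto simp: L0_nhd_def carrier_L0 add_L0)
  then show ?thesis
    unfolding topspace_def openin_L0_topology by (auto simp: L0_open_def)
qed

lemma topspace_L0_seq_topology: "topspace (L0_seq_topology M) = carrier (L0_seq M)"
  by (simp add: L0_seq_topology_def L0_seq_def topspace_L0_topology PiE_UNIV_domain)

lemma ae_classes_iff:
  assumes f: "\<And>n. f n \<in> borel_measurable M"
    and P: "\<And>g. (\<And>n. g n \<in> borel_measurable M) \<Longrightarrow> AE x in M. \<forall>n. g n x = f n x \<Longrightarrow> P g \<Longrightarrow> P f"
  shows "(\<lambda>n. ae_class M (f n)) \<in> ae_classes M P \<longleftrightarrow> P f"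
proof
  assume "(\<lambda>n. ae_class M (f n)) \<in> ae_classes M P"
  then obtain g where g: "\<And>n. g n \<in> borel_measurable M" "P g"
    and eq: "\<And>n. ae_class M (g n) = ae_class M (f n)"
    by (auto simp: ae_classes_def fun_eq_iff)
  have "AE x in M. \<forall>n. g n x = f n x"
    using eq g f by (simp add: AE_all_countable ae_class_eq_iff)
  then show "P f"
    using P g by blast
qed (use f in \<open>auto simp: ae_classes_def\<close>)

lemma uniform_limit_AE_cong:
  assumes "AE x in M. \<forall>n. g n x = f n x"
    and "Z \<in> sets M" "uniform_limit (space M - Z) g (\<lambda>x. 0::real) sequentially"
  shows "\<exists>Z'\<in>sets M. emeasure M Z' = emeasure M Z \<and>
    uniform_limit (space M - Z') f (\<lambda>x. 0) sequentially"
proof -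
  obtain N where N: "N \<in> null_sets M" "{x \<in> space M. \<not> (\<forall>n. g n x = f n x)} \<subseteq> N"
    using assms(1) by (auto elim!: AE_E simp: null_sets_def)
  have "uniform_limit (space M - (Z \<union> N)) g (\<lambda>x. 0) sequentially"
    using assms(3) by (rule uniform_limit_on_subset) auto
  then have "uniform_limit (space M - (Z \<union> N)) f (\<lambda>x. 0) sequentially"
    by (rule uniform_limit_cong'[THEN iffD1, rotated 2]) (use N in auto)
  then show ?thesis
    using assms(2) N by (intro bexI[of _ "Z \<union> N"]) (auto simp: emeasure_Un_null_set)
qed

lemma S_p_iff:
  assumes "\<And>n. f n \<in> borel_measurable M"
  shows "(\<lambda>n. ae_class M (f n)) \<in> S_p M \<longleftrightarrow> (AE x in M. (\<lambda>n. f n x) \<longlonglongrightarrow> 0)"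
  unfolding S_p_def
proof (rule ae_classes_iff[OF assms])
  fix g
  assume "AE x in M. \<forall>n. g n x = f n x" "AE x in M. (\<lambda>n. g n x) \<longlonglongrightarrow> 0"
  then show "AE x in M. (\<lambda>n. f n x) \<longlonglongrightarrow> 0"
    by eventually_elim simp
qed

lemma S_u_iff:
  assumes "\<And>n. f n \<in> borel_measurable M"
  shows "(\<lambda>n. ae_class M (f n)) \<in> S_u M \<longleftrightarrow> (\<exists>Z\<in>sets M. emeasure M Z = 0 \<and>
     uniform_limit (space M - Z) f (\<lambda>x. 0) sequentially)"
  unfolding S_u_def
proof (rule ae_classes_iff[OF assms])
  fix g
  assume eq: "AE x in M. \<forall>n. g n x = f n x"
    and "\<exists>Z\<in>sets M. emeasure M Z = 0 \<and> uniform_limit (space M - Z) g (\<lambda>x. 0) sequentially"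
  then obtain Z where Z: "Z \<in> sets M" "emeasure M Z = 0"
    "uniform_limit (space M - Z) g (\<lambda>x. 0) sequentially"
    by blast
  then show "\<exists>Z\<in>sets M. emeasure M Z = 0 \<and> uniform_limit (space M - Z) f (\<lambda>x. 0) sequentially"
    using uniform_limit_AE_cong[OF eq Z(1,3)] by auto
qed

lemma S_au_iff:
  assumes "\<And>n. f n \<in> borel_measurable M"
  shows "(\<lambda>n. ae_class M (f n)) \<in> S_au M \<longleftrightarrow>
     (\<forall>\<epsilon>>0::real. \<exists>Z\<in>sets M. emeasure M Z < ennreal \<epsilon> \<and>
        uniform_limit (space M - Z) f (\<lambda>x. 0) sequentially)"
  unfolding S_au_def
proof (rule ae_classes_iff[OF assms], intro allI impI)
  fix g and \<epsilon> :: real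
  assume eq: "AE x in M. \<forall>n. g n x = f n x" and "\<epsilon> > 0"
    and "\<forall>\<epsilon>>0::real. \<exists>Z\<in>sets M. emeasure M Z < ennreal \<epsilon> \<and>
        uniform_limit (space M - Z) g (\<lambda>x. 0) sequentially"
  then obtain Z where Z: "Z \<in> sets M" "emeasure M Z < ennreal \<epsilon>"
    "uniform_limit (space M - Z) g (\<lambda>x. 0) sequentially"
    by blast
  then show "\<exists>Z\<in>sets M. emeasure M Z < ennreal \<epsilon> \<and>
        uniform_limit (space M - Z) f (\<lambda>x. 0) sequentially"
    using uniform_limit_AE_cong[OF eq Z(1,3)] by (elim bexE conjE, intro bexI conjI) simp_all
qed

lemma S_m_iff:
  assumes f: "\<And>n. f n \<in> borel_measurable M"
  shows "(\<lambda>n. ae_class M (f n)) \<in> S_m M \<longleftrightarrow>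
     (\<forall>\<epsilon>>0::real. (\<lambda>n. emeasure M {x \<in> space M. \<bar>f n x\<bar> > \<epsilon>}) \<longlonglongrightarrow> 0)"
  unfolding S_m_def
proof (rule ae_classes_iff[OF f])
  fix g
  assume g: "\<And>n. g n \<in> borel_measurable M" and eq: "AE x in M. \<forall>n. g n x = f n x"
    and lim: "\<forall>\<epsilon>>0::real. (\<lambda>n. emeasure M {x \<in> space M. \<bar>g n x\<bar> > \<epsilon>}) \<longlonglongrightarrow> 0"
  have "emeasure M {x \<in> space M. \<bar>g n x\<bar> > \<epsilon>} = emeasure M {x \<in> space M. \<bar>f n x\<bar> > \<epsilon>}"
    for n and \<epsilon> :: real
  proof (rule emeasure_eq_AE)
    show "AE x in M. x \<in> {x \<in> space M. \<bar>g n x\<bar> > \<epsilon>} \<longleftrightarrow> x \<in> {x \<in> space M. \<bar>f n x\<bar> > \<epsilon>}"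
      using eq by (auto elim: eventually_mono)
  qed (use f g in measurable)
  then show "\<forall>\<epsilon>>0::real. (\<lambda>n. emeasure M {x \<in> space M. \<bar>f n x\<bar> > \<epsilon>}) \<longlonglongrightarrow> 0"
    using lim by simp
qed

lemma S_L_iff:
  assumes "\<And>n. f n \<in> borel_measurable M"
  shows "(\<lambda>n. ae_class M (f n)) \<in> S_L M q \<longleftrightarrow>
     (\<lambda>n. \<integral>\<^sup>+x. ennreal (\<bar>f n x\<bar> powr q) \<partial>M) \<longlonglongrightarrow> 0"
  unfolding S_L_def
proof (rule ae_classes_iff[OF assms])
  fix g
  assume eq: "AE x in M. \<forall>n. g n x = f n x"
    and lim: "(\<lambda>n. \<integral>\<^sup>+x. ennreal (\<bar>g n x\<bar> powr q) \<partial>M) \<longlonglongrightarrow> 0"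
  have "(\<integral>\<^sup>+x. ennreal (\<bar>g n x\<bar> powr q) \<partial>M) = (\<integral>\<^sup>+x. ennreal (\<bar>f n x\<bar> powr q) \<partial>M)" for n
    using eq by (intro nn_integral_cong_AE) (auto elim: eventually_mono)
  then show "(\<lambda>n. \<integral>\<^sup>+x. ennreal (\<bar>f n x\<bar> powr q) \<partial>M) \<longlonglongrightarrow> 0"
    using lim by simp
qed

end

theory Submission
  imports Defs "HOL-Real_Asymp.Real_Asymp"
begin

text \<open>
  Since \<open>\<mu>(\<Omega>) = \<infinity>\<close>, a nonzero constant has infinite integral, so a sequence that is eventually
  constant in \<open>x\<close> with nonzero values \<open>c\<^sub>n \<longlonglongrightarrow> 0\<close> tends to 0 uniformly but in no \<open>L\<^sub>q\<close>. The sequences of constants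
  \<open>e\<^bsup>-tn\<^esup>\<close>, \<open>t > 0\<close>, have this property together with all their nontrivial linear combinations,
  because the smallest exponent dominates. The property does not depend on finitely many terms, and
  in the product topology density only concerns finitely many terms: replacing an initial segment
  of the \<open>t\<close>-th sequence by a finite list over a countable dense subset of \<open>L\<^sub>0\<close>, in such a way that
  every list occurs, gives a basis of the desired subspace.
\<close>

section \<open>Inclusions between the sets of null sequences\<close>

lemma ae_classes_mono:
  assumes "\<And>f. (\<And>n. f n \<in> borel_measurable M) \<Longrightarrow> P f \<Longrightarrow> Q f"
  shows "ae_classes M P \<subseteq> ae_classes M Q"
  using assms unfolding ae_classes_def by blast

lemma S_u_subset_S_p: "S_u (M :: 'a measure) \<subseteq> S_p M"
  unfolding S_u_def S_p_def
proof (rule ae_classes_mono)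
  fix f :: "nat \<Rightarrow> 'a \<Rightarrow> real"
  assume "\<exists>Z\<in>sets M. emeasure M Z = 0 \<and> uniform_limit (space M - Z) f (\<lambda>x. 0) sequentially"
  then obtain Z where Z: "Z \<in> null_sets M" "uniform_limit (space M - Z) f (\<lambda>x. 0) sequentially"
    by blast
  have "(\<lambda>n. f n x) \<longlonglongrightarrow> 0" if "x \<in> space M - Z" for x
    using tendsto_uniform_limitI[OF Z(2) that] .
  then show "AE x in M. (\<lambda>n. f n x) \<longlonglongrightarrow> 0"
    by (intro AE_I'[OF Z(1)]) auto
qed

text \<open>A single null set serves as exceptional set for every \<open>\<epsilon>\<close>.\<close>

lemma S_u_subset_S_au: "S_u (M :: 'a measure) \<subseteq> S_au M"
  unfolding S_u_def S_au_def by (rule ae_classes_mono) (metis ennreal_less_zero_iff)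

text \<open>From some index on, the set where \<open>\<bar>f n x\<bar>\<close> exceeds
  \<open>\<epsilon>\<close> is contained in the exceptional null set, so its measure is exactly 0
  and not merely small.\<close>

lemma S_u_subset_S_m: "S_u (M :: 'a measure) \<subseteq> S_m M"
  unfolding S_u_def S_m_def
proof (rule ae_classes_mono, intro allI impI)
  fix f :: "nat \<Rightarrow> 'a \<Rightarrow> real" and \<epsilon> :: real
  assume "\<exists>Z\<in>sets M. emeasure M Z = 0 \<and> uniform_limit (space M - Z) f (\<lambda>x. 0) sequentially"
    and "\<epsilon> > 0"
  then obtain Z where Z: "Z \<in> null_sets M"
    and "\<forall>\<^sub>F n in sequentially. \<forall>x\<in>space M - Z. dist (f n x) 0 < \<epsilon>"
    using uniform_limitD by blast
  from this(2) have "\<forall>\<^sub>F n in sequentially. emeasure M {x \<in> space M. \<bar>f n x\<bar> > \<epsilon>} = 0"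
  proof eventually_elim
    case (elim n)
    then have "{x \<in> space M. \<bar>f n x\<bar> > \<epsilon>} \<subseteq> Z"
      by (force simp: dist_real_def)
    then show ?case
      using Z by (metis emeasure_mono le_zero_eq null_setsD1 null_setsD2)
  qed
  then show "(\<lambda>n. emeasure M {x \<in> space M. \<bar>f n x\<bar> > \<epsilon>}) \<longlonglongrightarrow> 0"
    by (rule tendsto_eventually)
qed

lemma continuum_dense_lineable_mono:
  "continuum_dense_lineable E T A \<Longrightarrow> A \<subseteq> B \<Longrightarrow> continuum_dense_lineable E T B"
  unfolding continuum_dense_lineable_def by blast


section \<open>Exponential sequences\<close>

text \<open>Let \<open>m\<close> be the smallest exponent with a nonzero coefficient. Multiplied by
  \<open>exp (m * n)\<close>, the sum tends to \<open>b m\<close>, since every other term vanishes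
  identically or decays. A sequence with nonzero limit is eventually nonzero, and the positive
  factor does not affect this.\<close>

lemma exp_sum_eventually_nonzero:
  fixes b :: "real \<Rightarrow> real"
  assumes "finite T" "s \<in> T" "b s \<noteq> 0"
  shows "\<forall>\<^sub>F n in sequentially. (\<Sum>t\<in>T. b t * exp (- t * real n)) \<noteq> 0"
proof -
  define m where "m = Min {t\<in>T. b t \<noteq> 0}"
  have m: "m \<in> T" "b m \<noteq> 0"
    using Min_in[of "{t\<in>T. b t \<noteq> 0}"] assms unfolding m_def by auto
  have min: "m \<le> t" if "t \<in> T" "b t \<noteq> 0" for t
    using that assms(1) unfolding m_def by auto
  have "(\<lambda>n. b t * exp ((m - t) * real n)) \<longlonglongrightarrow> (if t = m then b m else 0)" if "t \<in> T" for t
  proof (cases "t = m \<or> b t = 0")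
    case False
    then have "m - t < 0"
      using min[OF that] by auto
    then have "(\<lambda>n. b t * exp ((m - t) * real n)) \<longlonglongrightarrow> 0"
      by real_asymp
    then show ?thesis
      using False by simp
  qed auto
  then have "(\<lambda>n. \<Sum>t\<in>T. b t * exp ((m - t) * real n)) \<longlonglongrightarrow> (\<Sum>t\<in>T. if t = m then b m else 0)"
    by (rule tendsto_sum)
  then have "(\<lambda>n. \<Sum>t\<in>T. b t * exp ((m - t) * real n)) \<longlonglongrightarrow> b m"
    using m(1) assms(1) by simp
  then have "\<forall>\<^sub>F n in sequentially. (\<Sum>t\<in>T. b t * exp ((m - t) * real n)) \<noteq> 0"
    by (rule tendsto_imp_eventually_ne) (use m(2) in simp)
  moreover have "(\<Sum>t\<in>T. b t * exp ((m - t) * real n)) =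
      exp (m * real n) * (\<Sum>t\<in>T. b t * exp (- t * real n))" for n
    by (simp add: sum_distrib_left left_diff_distrib exp_diff exp_minus field_simps)
  ultimately show ?thesis
    by simp
qed

lemma exp_sum_tendsto_zero:
  fixes b :: "real \<Rightarrow> real"
  assumes "T \<subseteq> {0<..}"
  shows "(\<lambda>n. \<Sum>t\<in>T. b t * exp (- t * real n)) \<longlonglongrightarrow> 0"
proof (rule tendsto_null_sum)
  fix t assume "t \<in> T"
  then have "t > 0"
    using assms by auto
  then show "(\<lambda>n. b t * exp (- t * real n)) \<longlonglongrightarrow> 0"
    by real_asymp
qed

section \<open>Sequences of eventually constant functions: uniform convergence without convergence
  in any \<open>L_q\<close>\<close>

lemma eventually_constant_in_S_u:
  assumes f: "\<And>n. f n \<in> borel_measurable M"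
    and ev: "\<forall>\<^sub>F n in sequentially. \<forall>x. f n x = c n" and "c \<longlonglongrightarrow> 0"
  shows "(\<lambda>n. ae_class M (f n)) \<in> S_u M"
proof -
  have "uniform_limit (space M - {}) f (\<lambda>x. 0) sequentially"
  proof (rule uniform_limitI)
    fix e :: real assume "e > 0"
    then have "\<forall>\<^sub>F n in sequentially. dist (c n) 0 < e"
      using assms(3) tendstoD by blast
    with ev show "\<forall>\<^sub>F n in sequentially. \<forall>x\<in>space M - {}. dist (f n x) 0 < e"
      by eventually_elim simp
  qed
  then show ?thesis
    unfolding S_u_iff[OF f] by (metis emeasure_empty sets.empty_sets)
qed

text \<open>The integral of the nonzero constant \<open>\<bar>c n\<bar> powr q\<close> over a space
  of infinite measure is infinite, so the integrals are eventually \<open>\<infinity>\<close>,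
  whatever \<open>q\<close> is.\<close>

lemma eventually_nonzero_constant_notin_S_L:
  assumes f: "\<And>n. f n \<in> borel_measurable M" and inf: "emeasure M (space M) = \<infinity>"
    and ev: "\<forall>\<^sub>F n in sequentially. \<forall>x. f n x = c n" "\<forall>\<^sub>F n in sequentially. c n \<noteq> 0"
  shows "(\<lambda>n. ae_class M (f n)) \<notin> S_L M q"
proof -
  have "\<forall>\<^sub>F n in sequentially. (\<integral>\<^sup>+x. ennreal (\<bar>f n x\<bar> powr q) \<partial>M) = \<infinity>"
    using ev by eventually_elim (simp add: inf ennreal_mult_top)
  then have "(\<lambda>n. \<integral>\<^sup>+x. ennreal (\<bar>f n x\<bar> powr q) \<partial>M) \<longlonglongrightarrow> \<infinity>"
    by (rule tendsto_eventually)
  then show ?thesis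
    unfolding S_L_iff[OF f] using LIMSEQ_unique by fastforce
qed


section \<open>Rational step functions\<close>

text \<open>Rational coefficients and a countable supply of sets leave only countably many such
  functions. The sets may overlap or repeat, so that prepending a pair to the list simply adds one
  term.\<close>

definition step_fun :: "(rat \<times> 'a set) list \<Rightarrow> 'a \<Rightarrow> real" where
  "step_fun l = (\<lambda>x. \<Sum>(q, A)\<leftarrow>l. of_rat q * indicator A x)"

lemma borel_measurable_step_fun:
  "l \<in> lists (UNIV \<times> sets M) \<Longrightarrow> step_fun l \<in> borel_measurable M"
  unfolding step_fun_def by (induction l) auto

text \<open>Inside \<open>K\<close> the error splits in two: where \<open>E\<close> and
  \<open>A\<close> agree it is at most \<open>\<bar>c - of_rat q\<bar>\<close>, and where they
  disagree the truncation bounds it by 1, so that it costs no more than the measure of the symmetric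
  difference.\<close>

lemma approx_indicator:
  assumes dense: "\<And>E \<epsilon>. E \<in> sets M \<Longrightarrow> emeasure M E < \<infinity> \<Longrightarrow> \<epsilon> > (0::real) \<Longrightarrow>
       \<exists>E\<^sub>0\<in>\<A>. emeasure M ((E - E\<^sub>0) \<union> (E\<^sub>0 - E)) < ennreal \<epsilon>"
    and "\<A> \<subseteq> sets M" "A \<in> sets M" "K \<in> sets M" "emeasure M K < \<infinity>" "\<epsilon> > 0"
  shows "\<exists>q. \<exists>E\<in>\<A>. (\<integral>\<^sup>+x\<in>K. ennreal (min 1 \<bar>c * indicator A x - of_rat q * indicator E x\<bar>) \<partial>M)
     < ennreal \<epsilon>"
proof -
  define k where "k = measure M K"
  have k: "emeasure M K = ennreal k" "k \<ge> 0"
    using assms(5) by (auto simp: k_def emeasure_eq_ennreal_measure)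
  \<comment> \<open>An error of \<open>\<delta>\<close> on all of \<open>K\<close> integrates to at
    most half of \<open>\<epsilon>\<close>; \<open>k + 1\<close> keeps the denominator positive when
    \<open>K\<close> is a null set.\<close>
  define \<delta> where "\<delta> = \<epsilon> / (2 * (k + 1))"
  have \<delta>: "\<delta> > 0" "\<delta> * k \<le> \<epsilon> / 2"
    using k assms(6) by (auto simp: \<delta>_def field_simps)
  obtain q where "c < of_rat q" "of_rat q < c + \<delta>"
    using of_rat_dense[of c "c + \<delta>"] \<delta> by auto
  then have q: "\<bar>c - of_rat q\<bar> \<le> \<delta>"
    by auto
  \<comment> \<open>\<open>A\<close> itself may have infinite measure, so only its part in
    \<open>K\<close> is approximated; what happens outside \<open>K\<close> is not seen by the
    integral.\<close>
  have "A \<inter> K \<in> sets M" "\<epsilon> / 2 > 0"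
    using assms by auto
  moreover have "emeasure M (A \<inter> K) < \<infinity>"
    using assms(3-5) by (metis Int_lower2 emeasure_mono order_le_less_trans)
  ultimately obtain E where E: "E \<in> \<A>" "emeasure M ((A \<inter> K - E) \<union> (E - A \<inter> K)) < ennreal (\<epsilon> / 2)"
    using dense by blast
  define D where "D = (A \<inter> K - E) \<union> (E - A \<inter> K)"
  have [measurable]: "E \<in> sets M" "A \<in> sets M" "K \<in> sets M" "D \<in> sets M"
    using E assms by (auto simp: D_def)
  have "(\<integral>\<^sup>+x\<in>K. ennreal (min 1 \<bar>c * indicator A x - of_rat q * indicator E x\<bar>) \<partial>M)
      \<le> (\<integral>\<^sup>+x. ennreal \<delta> * indicator K x + indicator D x \<partial>M)"
  proof (rule nn_integral_mono)
    fix x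
    consider "x \<notin> K" | "x \<in> D" "x \<in> K" | "x \<notin> D" "x \<in> K"
      by blast
    then show "ennreal (min 1 \<bar>c * indicator A x - of_rat q * indicator E x\<bar>) * indicator K x
        \<le> ennreal \<delta> * indicator K x + indicator D x"
    proof cases
      case 2
      have "ennreal (min 1 \<bar>c * indicator A x - of_rat q * indicator E x\<bar>) \<le> 1"
        by (metis ennreal_1 ennreal_leI min.cobounded1)
      then show ?thesis
        using 2 by (simp add: add_increasing)
    next
      case 3
      then have "x \<in> A \<longleftrightarrow> x \<in> E"
        by (auto simp: D_def)
      then have "\<bar>c * indicator A x - of_rat q * indicator E x\<bar> \<le> \<delta>"
        using q \<delta>(1) by (auto split: split_indicator)
      then show ?thesis
        using 3 by (simp add: ennreal_leI min.coboundedI2)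
    qed simp
  qed
  also have "\<dots> = ennreal (\<delta> * k) + emeasure M D"
    using k \<delta>(1) by (subst nn_integral_add) (auto simp: nn_integral_cmult ennreal_mult)
  also have "\<dots> \<le> ennreal (\<epsilon> / 2) + emeasure M D"
    using \<delta>(2) by (intro add_right_mono ennreal_leI)
  also have "\<dots> < ennreal (\<epsilon> / 2) + ennreal (\<epsilon> / 2)"
    using E(2) by (simp add: D_def ennreal_add_left_cancel_less)
  also have "\<dots> = ennreal \<epsilon>"
    using assms(6) by (subst ennreal_plus[symmetric]) auto
  finally show ?thesis
    using E(1) by blast
qed

text \<open>The truncation \<open>min 1 \<bar>y\<bar>\<close> is subadditive in \<open>y\<close>.
  This is the triangle inequality behind all the splittings of \<open>\<epsilon>\<close> into halves
  below.\<close>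

lemma set_nn_integral_min_triangle:
  assumes [measurable]: "f \<in> borel_measurable M" "g \<in> borel_measurable M" "K \<in> sets M"
  shows "(\<integral>\<^sup>+x\<in>K. ennreal (min 1 \<bar>f x + g x\<bar>) \<partial>M) \<le>
     (\<integral>\<^sup>+x\<in>K. ennreal (min 1 \<bar>f x\<bar>) \<partial>M) + (\<integral>\<^sup>+x\<in>K. ennreal (min 1 \<bar>g x\<bar>) \<partial>M)"
proof -
  have "(\<integral>\<^sup>+x\<in>K. ennreal (min 1 \<bar>f x + g x\<bar>) \<partial>M) \<le>
     (\<integral>\<^sup>+x. ennreal (min 1 \<bar>f x\<bar>) * indicator K x + ennreal (min 1 \<bar>g x\<bar>) * indicator K x \<partial>M)"
    by (intro nn_integral_mono)
      (auto simp flip: ennreal_plus intro!: ennreal_leI split: split_indicator)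
  also have "\<dots> = (\<integral>\<^sup>+x\<in>K. ennreal (min 1 \<bar>f x\<bar>) \<partial>M) + (\<integral>\<^sup>+x\<in>K. ennreal (min 1 \<bar>g x\<bar>) \<partial>M)"
    by (rule nn_integral_add) auto
  finally show ?thesis .
qed

text \<open>Induction on the index set: half of \<open>\<epsilon>\<close> pays for the new indicator
  and the other half for the remaining sum, which is why \<open>\<epsilon>\<close> is arbitrary in
  the induction.\<close>

lemma approx_sum_indicators:
  assumes dense: "\<And>E \<epsilon>. E \<in> sets M \<Longrightarrow> emeasure M E < \<infinity> \<Longrightarrow> \<epsilon> > (0::real) \<Longrightarrow>
       \<exists>E\<^sub>0\<in>\<A>. emeasure M ((E - E\<^sub>0) \<union> (E\<^sub>0 - E)) < ennreal \<epsilon>"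
    and "\<A> \<subseteq> sets M" "K \<in> sets M" "emeasure M K < \<infinity>"
    and "finite I" "\<And>i. i \<in> I \<Longrightarrow> A i \<in> sets M" "\<epsilon> > 0"
  shows "\<exists>l\<in>lists (UNIV \<times> \<A>).
     (\<integral>\<^sup>+x\<in>K. ennreal (min 1 \<bar>(\<Sum>i\<in>I. c i * indicator (A i) x) - step_fun l x\<bar>) \<partial>M) < ennreal \<epsilon>"
  using assms(5-7)
proof (induction I arbitrary: \<epsilon> rule: finite_induct)
  case empty
  then show ?case
    by (intro bexI[of _ "[]"]) (auto simp: step_fun_def)
next
  case (insert j I)
  define f where "f x = (\<Sum>i\<in>I. c i * indicator (A i) x)" for x
  obtain l where l: "l \<in> lists (UNIV \<times> \<A>)"
    "(\<integral>\<^sup>+x\<in>K. ennreal (min 1 \<bar>f x - step_fun l x\<bar>) \<partial>M) < ennreal (\<epsilon> / 2)"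
    using insert.IH[of "\<epsilon> / 2"] insert.prems unfolding f_def by auto
  obtain q E where E: "E \<in> \<A>"
    "(\<integral>\<^sup>+x\<in>K. ennreal (min 1 \<bar>c j * indicator (A j) x - of_rat q * indicator E x\<bar>) \<partial>M)
       < ennreal (\<epsilon> / 2)"
    using approx_indicator[OF dense assms(2) _ assms(3,4), of "A j" "\<epsilon> / 2" "c j"] insert.prems by auto
  have [measurable]: "f \<in> borel_measurable M" "step_fun l \<in> borel_measurable M"
    "A j \<in> sets M" "E \<in> sets M" "K \<in> sets M"
    using insert.prems l(1) E(1) assms(2,3) lists_mono[of "UNIV \<times> \<A>" "UNIV \<times> sets M"]
    by (auto simp: f_def[abs_def] intro!: borel_measurable_step_fun)
  have "(\<Sum>i\<in>insert j I. c i * indicator (A i) x) - step_fun ((q, E) # l) x =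
      (c j * indicator (A j) x - of_rat q * indicator E x) + (f x - step_fun l x)" for x
    unfolding step_fun_def f_def
    by (simp only: sum.insert[OF insert.hyps] list.map sum_list.Cons split_conv)
  then have "(\<integral>\<^sup>+x\<in>K. ennreal (min 1 \<bar>(\<Sum>i\<in>insert j I. c i * indicator (A i) x) -
        step_fun ((q, E) # l) x\<bar>) \<partial>M)
      \<le> (\<integral>\<^sup>+x\<in>K. ennreal (min 1 \<bar>c j * indicator (A j) x - of_rat q * indicator E x\<bar>) \<partial>M) +
        (\<integral>\<^sup>+x\<in>K. ennreal (min 1 \<bar>f x - step_fun l x\<bar>) \<partial>M)"
    by (simp only:) (rule set_nn_integral_min_triangle; measurable)
  also have "\<dots> < ennreal (\<epsilon> / 2) + ennreal (\<epsilon> / 2)"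
    using E(2) l(2) by (rule add_strict_mono)
  also have "\<dots> = ennreal \<epsilon>"
    using insert.prems by (subst ennreal_plus[symmetric]) auto
  finally show ?case
    using E(1) l(1) by (intro bexI[of _ "(q, E) # l"]) auto
qed

text \<open>The countable set of step functions over \<open>\<A>\<close> is dense in
  \<open>L_0\<close>: a measurable function is first approximated by a simple function, and that one
  by a rational step function.\<close>

lemma approx_step_fun:
  assumes dense: "\<And>E \<epsilon>. E \<in> sets M \<Longrightarrow> emeasure M E < \<infinity> \<Longrightarrow> \<epsilon> > (0::real) \<Longrightarrow>
       \<exists>E\<^sub>0\<in>\<A>. emeasure M ((E - E\<^sub>0) \<union> (E\<^sub>0 - E)) < ennreal \<epsilon>"
    and "\<A> \<subseteq> sets M" and K [measurable]: "K \<in> sets M" and "emeasure M K < \<infinity>"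
    and f [measurable]: "f \<in> borel_measurable M" and "\<epsilon> > 0"
  shows "\<exists>l\<in>lists (UNIV \<times> \<A>). (\<integral>\<^sup>+x\<in>K. ennreal (min 1 \<bar>f x - step_fun l x\<bar>) \<partial>M) < ennreal \<epsilon>"
proof -
  obtain s where s: "\<And>i. simple_function M (s i)" "\<And>x. x \<in> space M \<Longrightarrow> (\<lambda>i. s i x) \<longlonglongrightarrow> f x"
    using borel_measurable_implies_sequence_metric[OF f] by blast
  have [measurable]: "s i \<in> borel_measurable M" for i
    using s(1) by (rule borel_measurable_simple_function)
  have "(\<lambda>i. \<integral>\<^sup>+x\<in>K. ennreal (min 1 \<bar>f x - s i x\<bar>) \<partial>M) \<longlonglongrightarrow> (\<integral>\<^sup>+x. 0 \<partial>M)"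
  \<comment> \<open>The truncation makes the indicator of \<open>K\<close> a majorant, which is
    integrable because \<open>K\<close> has finite measure. Hence pointwise convergence suffices,
    without any bound on \<open>f\<close>.\<close>
  proof (rule nn_integral_dominated_convergence[where w = "indicator K"])
    show "AE x in M. ennreal (min 1 \<bar>f x - s i x\<bar>) * indicator K x \<le> indicator K x" for i
      by (intro AE_I2) (auto split: split_indicator)
    show "(\<integral>\<^sup>+x. indicator K x \<partial>M) < \<infinity>"
      using assms(4) by simp
    have "(\<lambda>i. ennreal (min 1 \<bar>f x - s i x\<bar>) * indicator K x) \<longlonglongrightarrow> 0" if "x \<in> space M" for x
    proof -
      have "(\<lambda>i. min 1 \<bar>f x - s i x\<bar>) \<longlonglongrightarrow> min 1 \<bar>f x - f x\<bar>"
        by (intro tendsto_intros s(2) that)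
      then have "(\<lambda>i. ennreal (min 1 \<bar>f x - s i x\<bar>)) \<longlonglongrightarrow> ennreal 0"
        by (intro tendsto_ennrealI) simp
      then show ?thesis
        by (auto split: split_indicator)
    qed
    then show "AE x in M. (\<lambda>i. ennreal (min 1 \<bar>f x - s i x\<bar>) * indicator K x) \<longlonglongrightarrow> 0"
      by simp
  qed simp_all
  then have "\<forall>\<^sub>F i in sequentially. (\<integral>\<^sup>+x\<in>K. ennreal (min 1 \<bar>f x - s i x\<bar>) \<partial>M) < ennreal (\<epsilon> / 2)"
    by (rule order_tendstoD) (use assms(6) in simp)
  then obtain i where i: "(\<integral>\<^sup>+x\<in>K. ennreal (min 1 \<bar>f x - s i x\<bar>) \<partial>M) < ennreal (\<epsilon> / 2)"
    using eventually_happens'[OF sequentially_bot] by blast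
  \<comment> \<open>The canonical representation of \<open>s i\<close> by its level sets; it agrees
    with \<open>s i\<close> only on the underlying space, which is enough under the
    integral.\<close>
  define g where "g x = (\<Sum>y\<in>s i ` space M. y * indicator (s i -` {y} \<inter> space M) x)" for x
  have g: "g x = s i x" if "x \<in> space M" for x
  proof -
    have "g x = (\<Sum>y\<in>s i ` space M. if y = s i x then y else 0)"
      unfolding g_def using that by (intro sum.cong) auto
    then show ?thesis
      using that s(1)[of i] by (simp add: simple_function_def)
  qed
  obtain l where l: "l \<in> lists (UNIV \<times> \<A>)"
    "(\<integral>\<^sup>+x\<in>K. ennreal (min 1 \<bar>g x - step_fun l x\<bar>) \<partial>M) < ennreal (\<epsilon> / 2)"
    using approx_sum_indicators[OF dense assms(2-4), of "s i ` space M"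
        "\<lambda>y. s i -` {y} \<inter> space M" "\<epsilon> / 2" "\<lambda>y. y"] s(1) assms(6)
    unfolding g_def by (auto simp: simple_function_def)
  have [measurable]: "step_fun l \<in> borel_measurable M"
    using l(1) assms(2) lists_mono[of "UNIV \<times> \<A>" "UNIV \<times> sets M"]
    by (auto intro!: borel_measurable_step_fun)
  have "(\<integral>\<^sup>+x\<in>K. ennreal (min 1 \<bar>g x - step_fun l x\<bar>) \<partial>M) =
      (\<integral>\<^sup>+x\<in>K. ennreal (min 1 \<bar>s i x - step_fun l x\<bar>) \<partial>M)"
    by (intro nn_integral_cong) (simp add: g)
  then have l': "(\<integral>\<^sup>+x\<in>K. ennreal (min 1 \<bar>s i x - step_fun l x\<bar>) \<partial>M) < ennreal (\<epsilon> / 2)"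
    using l(2) by simp
  have "(\<integral>\<^sup>+x\<in>K. ennreal (min 1 \<bar>f x - step_fun l x\<bar>) \<partial>M) =
      (\<integral>\<^sup>+x\<in>K. ennreal (min 1 \<bar>(f x - s i x) + (s i x - step_fun l x)\<bar>) \<partial>M)"
    by simp
  also have "\<dots> \<le> (\<integral>\<^sup>+x\<in>K. ennreal (min 1 \<bar>f x - s i x\<bar>) \<partial>M) +
      (\<integral>\<^sup>+x\<in>K. ennreal (min 1 \<bar>s i x - step_fun l x\<bar>) \<partial>M)"
    by (rule set_nn_integral_min_triangle; measurable)
  also have "\<dots> < ennreal (\<epsilon> / 2) + ennreal (\<epsilon> / 2)"
    using i l' by (rule add_strict_mono)
  also have "\<dots> = ennreal \<epsilon>"
    using assms(6) by (subst ennreal_plus[symmetric]) auto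
  finally show ?thesis
    using l(1) by blast
qed


section \<open>The dense subspace\<close>

text \<open>A basic open set of the product restricts only finitely many coordinates. Elements of
  \<open>D\<close> can be chosen inside these coordinate sets, and \<open>prefix\<close> supplies a
  member of \<open>V\<close> that begins with the chosen list.\<close>

lemma closure_of_L0_seq_eq:
  assumes V: "V \<subseteq> carrier (L0_seq M)"
    and D: "D \<subseteq> borel_measurable M"
    and approx: "\<And>f K \<epsilon>. f \<in> borel_measurable M \<Longrightarrow> K \<in> sets M \<Longrightarrow> emeasure M K < \<infinity> \<Longrightarrow>
       \<epsilon> > (0::real) \<Longrightarrow> \<exists>d\<in>D. (\<integral>\<^sup>+x\<in>K. ennreal (min 1 \<bar>f x - d x\<bar>) \<partial>M) < ennreal \<epsilon>"
    and prefix: "\<And>ds. ds \<in> lists D \<Longrightarrow> \<exists>v\<in>V. \<forall>n<length ds. v n = ae_class M (ds ! n)"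
  shows "L0_seq_topology M closure_of V = topspace (L0_seq_topology M)"
proof -
  have "\<exists>v. v \<in> V \<and> v \<in> U" if F: "F \<in> U" and U: "openin (L0_seq_topology M) U" for F U
  proof -
    obtain Y where Y: "finite {i. Y i \<noteq> topspace (L0_topology M)}"
      "\<And>i. openin (L0_topology M) (Y i)" "\<And>i. F i \<in> Y i" "Pi\<^sub>E UNIV Y \<subseteq> U"
      using U F unfolding L0_seq_topology_def openin_product_topology_alt
      by (auto simp: PiE_UNIV_domain Pi_iff)
    obtain m where m: "\<And>i. Y i \<noteq> topspace (L0_topology M) \<Longrightarrow> i < m"
      using Y(1) finite_nat_bounded by (metis (mono_tags, lifting) lessThan_iff mem_Collect_eq subsetD)
    have "\<exists>d\<in>D. ae_class M d \<in> Y i" for i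
    proof -
      have open_X: "L0_open M (Y i)"
        using Y(2)[of i] by (simp add: openin_L0_topology)
      then obtain K \<epsilon> where K: "K \<in> sets M" "emeasure M K < \<infinity>" "\<epsilon> > 0"
        "\<forall>H\<in>L0_nhd M K \<epsilon>. F i \<oplus>\<^bsub>L0 M\<^esub> H \<in> Y i"
        using Y(3) unfolding L0_open_def by blast
      obtain f where f: "f \<in> borel_measurable M" "F i = ae_class M f"
        using open_X Y(3)[of i] unfolding L0_open_def carrier_L0 by blast
      obtain d where d: "d \<in> D" "(\<integral>\<^sup>+x\<in>K. ennreal (min 1 \<bar>f x - d x\<bar>) \<partial>M) < ennreal \<epsilon>"
        using approx[OF f(1) K(1-3)] by blast
      have "d \<in> borel_measurable M"
        using d(1) D by blast
      \<comment> \<open>Translating the class of \<open>f\<close> by this small element gives the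
        class of \<open>d\<close>.\<close>
      moreover from this have "ae_class M (\<lambda>x. d x - f x) \<in> L0_nhd M K \<epsilon>"
        unfolding L0_nhd_def using d(2) f(1) by (intro imageI) (simp add: abs_minus_commute)
      ultimately have "ae_class M d \<in> Y i"
        using K(4) f by (force simp: add_L0)
      then show ?thesis
        using d(1) by blast
    qed
    then obtain d where d: "\<And>i. d i \<in> D" "\<And>i. ae_class M (d i) \<in> Y i"
      by metis
    have "map d [0..<m] \<in> lists D"
      using d(1) by (simp add: in_lists_conv_set)
    then obtain v where v: "v \<in> V" "\<And>n. n < m \<Longrightarrow> v n = ae_class M (d n)"
      using prefix[of "map d [0..<m]"] by auto
    have "v n \<in> Y n" for n
    proof (cases "n < m")
      case False
      \<comment> \<open>Beyond \<open>m\<close> the coordinates are unrestricted, so nothing has to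
        be known about the tail of \<open>v\<close>.\<close>
      then have "Y n = carrier (L0 M)"
        using m topspace_L0_topology by metis
      then show ?thesis
        using v(1) V by (auto simp: L0_seq_def)
    qed (use v d in simp)
    then have "v \<in> U"
      using Y(4) by (auto simp: PiE_UNIV_domain)
    then show ?thesis
      using v(1) by blast
  qed
  then show ?thesis
    unfolding set_eq_iff in_closure_of by blast
qed

section \<open>Exponential sequences with prescribed initial segments\<close>

definition prefixed_exp :: "(real \<Rightarrow> ('a \<Rightarrow> real) list) \<Rightarrow> real \<Rightarrow> nat \<Rightarrow> 'a \<Rightarrow> real" where
  "prefixed_exp L t n = (if n < length (L t) then L t ! n else (\<lambda>x. exp (- t * real n)))"

lemma borel_measurable_prefixed_exp:
  assumes "\<And>t. L t \<in> lists (borel_measurable M)"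
  shows "prefixed_exp L t n \<in> borel_measurable M"
  using assms[of t] by (auto simp: prefixed_exp_def in_lists_conv_set)

text \<open>Moves linear combinations from equivalence classes to representatives, where they become
  pointwise finite sums.\<close>

lemma finsum_L0_seq:
  assumes "finite T" "\<And>t n. v t n \<in> borel_measurable M"
  shows "(\<Oplus>\<^bsub>L0_seq M\<^esub>t\<in>T. b t \<odot>\<^bsub>L0_seq M\<^esub> (\<lambda>n. ae_class M (v t n))) =
     (\<lambda>n. ae_class M (\<lambda>x. \<Sum>t\<in>T. b t * v t n x))"
  using assms(1)
proof (induction T rule: finite_induct)
  case empty
  interpret vectorspace real_field "L0_seq M" by (rule vectorspace_L0_seq)
  show ?case
    by (simp only: M.finsum_empty sum.empty) (simp add: L0_seq_def zero_L0)
next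
  case (insert s T)
  interpret vectorspace real_field "L0_seq M" by (rule vectorspace_L0_seq)
  have car: "b t \<odot>\<^bsub>L0_seq M\<^esub> (\<lambda>n. ae_class M (v t n)) \<in> carrier (L0_seq M)" for t
    using assms(2) by (auto simp: L0_seq_def smult_L0 carrier_L0 intro!: imageI)
  then show ?case
    using insert.hyps assms(2)
    by (subst M.finsum_insert) (auto simp: insert.IH, simp_all add: L0_seq_def smult_L0 add_L0)
qed

text \<open>Past all the prefixes of the finitely many sequences involved, the combination is a
  plain sum of exponentials, constant in \<open>x\<close>; the results on such sums then apply to
  its tail.\<close>

lemma prefixed_exp_combination:
  assumes L: "\<And>t. L t \<in> lists (borel_measurable M)" and inf: "emeasure M (space M) = \<infinity>"
    and T: "finite T" "T \<subseteq> {0<..}" "s \<in> T" "b s \<noteq> 0"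
  shows "(\<lambda>n. ae_class M (\<lambda>x. \<Sum>t\<in>T. b t * prefixed_exp L t n x)) \<in> S_u M - (\<Union>q\<in>{0<..}. S_L M q)"
proof -
  \<comment> \<open>The sum of the lengths is a common bound for the prefixes that also makes sense
    for arbitrary finite \<open>T\<close>.\<close>
  define N where "N = (\<Sum>t\<in>T. length (L t))"
  have "length (L t) \<le> N" if "t \<in> T" for t
    using T(1) that unfolding N_def by (intro member_le_sum) auto
  then have "(\<Sum>t\<in>T. b t * prefixed_exp L t n x) = (\<Sum>t\<in>T. b t * exp (- t * real n))"
    if "n \<ge> N" for n x
    using that by (intro sum.cong) (fastforce simp: prefixed_exp_def)+
  then have ev: "\<forall>\<^sub>F n in sequentially. \<forall>x. (\<Sum>t\<in>T. b t * prefixed_exp L t n x) =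
      (\<Sum>t\<in>T. b t * exp (- t * real n))"
    by (intro eventually_sequentiallyI) blast
  have [measurable]: "prefixed_exp L t n \<in> borel_measurable M" for t n
    using L by (rule borel_measurable_prefixed_exp)
  show ?thesis
    using eventually_constant_in_S_u[OF _ ev exp_sum_tendsto_zero[OF T(2)]]
      eventually_nonzero_constant_notin_S_L[OF _ inf ev
        exp_sum_eventually_nonzero[where b = b, OF T(1,3,4)]]
    by simp
qed

text \<open>Anything outside some \<open>S_L M q\<close> is therefore nonzero; this yields both
  injectivity of the parametrization and linear independence below.\<close>

lemma zero_in_S_L: "\<zero>\<^bsub>L0_seq M\<^esub> \<in> S_L M q"
proof -
  have "(\<lambda>n::nat. ae_class M (\<lambda>x. 0)) \<in> S_L M q"
    by (subst S_L_iff) auto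
  then show ?thesis
    by (simp add: L0_seq_def zero_L0)
qed

text \<open>The subspace is the span of the prefixed exponentials, one for each positive real. Every
  nontrivial combination lies in the target set and hence is nonzero, so one fact gives the
  independence of the family and the inclusion of the nonzero vectors.\<close>

lemma continuum_dense_lineable_S_u:
  assumes inf: "emeasure M (space M) = \<infinity>"
    and D: "countable D" "D \<subseteq> borel_measurable M"
    and approx: "\<And>f K \<epsilon>. f \<in> borel_measurable M \<Longrightarrow> K \<in> sets M \<Longrightarrow> emeasure M K < \<infinity> \<Longrightarrow>
       \<epsilon> > (0::real) \<Longrightarrow> \<exists>d\<in>D. (\<integral>\<^sup>+x\<in>K. ennreal (min 1 \<bar>f x - d x\<bar>) \<partial>M) < ennreal \<epsilon>"
  shows "continuum_dense_lineable (L0_seq M) (L0_seq_topology M)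
     (S_u M - (\<Union>q\<in>{0<..}. S_L M q))"
proof -
  interpret E: vectorspace real_field "L0_seq M" by (rule vectorspace_L0_seq)
  have R: "carrier real_field = UNIV" "\<zero>\<^bsub>real_field\<^esub> = 0"
    by (simp_all add: ring_of_type_algebra_def)
  \<comment> \<open>Only the surjectivity of \<open>L\<close> from the positive reals onto \<open>lists D\<close> matters.\<close>
  define L where "L t = from_nat_into (lists D) (nat \<lfloor>t\<rfloor>)" for t :: real
  have L: "L t \<in> lists D" for t
    unfolding L_def by (rule from_nat_into) auto
  then have L': "L t \<in> lists (borel_measurable M)" for t
    using D(2) lists_mono by blast
  define v where "v = prefixed_exp L"
  have v [measurable]: "v t n \<in> borel_measurable M" for t n
    unfolding v_def using L' by (rule borel_measurable_prefixed_exp)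
  define w where "w t = (\<lambda>n. ae_class M (v t n))" for t
  define B where "B = w ` {0<..}"
  have w_carrier: "w t \<in> carrier (L0_seq M)" for t
    using v by (auto simp: w_def L0_seq_def carrier_L0)
  then have B: "B \<subseteq> carrier (L0_seq M)"
    by (auto simp: B_def)
  have nontrivial: "(\<lambda>n. ae_class M (\<lambda>x. \<Sum>t\<in>T. b t * v t n x)) \<in> S_u M - (\<Union>q\<in>{0<..}. S_L M q)"
    if "finite T" "T \<subseteq> {0<..}" "s \<in> T" "b s \<noteq> 0" for T s b
    unfolding v_def using prefixed_exp_combination[where L = L and b = b, OF L' inf that] .
  \<comment> \<open>If two parameters gave the same sequence of classes, the difference would be a
    nontrivial combination equal to zero.\<close>
  have inj: "inj_on w {0<..}"
  proof (rule inj_onI, rule ccontr)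
    fix s t :: real assume st: "s \<in> {0<..}" "t \<in> {0<..}" "w s = w t" "s \<noteq> t"
    have "ae_class M (\<lambda>x. \<Sum>r\<in>{s, t}. (if r = s then 1 else - 1) * v r n x) = ae_class M (\<lambda>x. 0)" for n
    proof (subst ae_class_eq_iff)
      have "AE x in M. v s n x = v t n x"
        using fun_cong[OF st(3), of n] unfolding w_def by (subst (asm) ae_class_eq_iff) auto
      then show "AE x in M. (\<Sum>r\<in>{s, t}. (if r = s then 1 else - 1) * v r n x) = 0"
        by eventually_elim (use st(4) in simp)
    qed auto
    then have "(\<lambda>n. ae_class M (\<lambda>x. \<Sum>r\<in>{s, t}. (if r = s then 1 else - 1) * v r n x)) \<in> S_L M 1"
      using zero_in_S_L[of M 1] by (simp add: L0_seq_def zero_L0)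
    then show False
      using nontrivial[of "{s, t}" s "\<lambda>r. if r = s then 1 else - 1"] st by auto
  qed
  \<comment> \<open>By injectivity, a combination of vectors of \<open>B\<close> is a combination
    over a finite set of parameters, with coefficients \<open>a (w t)\<close>.\<close>
  have lincomb: "\<exists>T. finite T \<and> T \<subseteq> {0<..} \<and> A = w ` T \<and>
      E.lincomb a A = (\<lambda>n. ae_class M (\<lambda>x. \<Sum>t\<in>T. a (w t) * v t n x))"
    if A: "finite A" "A \<subseteq> B" for a A
  proof -
    obtain T where T: "T \<subseteq> {0<..}" "finite T" "A = w ` T"
      using finite_subset_image[OF A[unfolded B_def]] by blast
    have "E.lincomb a A = (\<Oplus>\<^bsub>L0_seq M\<^esub>t\<in>T. a (w t) \<odot>\<^bsub>L0_seq M\<^esub> w t)"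
      unfolding E.lincomb_def T(3) using inj_on_subset[OF inj T(1)] w_carrier R
      by (intro E.M.finsum_reindex) auto
    then show ?thesis
      using finsum_L0_seq[OF T(2) v, of "\<lambda>t. a (w t)"] T by (auto simp: w_def)
  qed
  have lincomb_notzero: "E.lincomb a A \<in> S_u M - (\<Union>q\<in>{0<..}. S_L M q)"
    if A: "finite A" "A \<subseteq> B" "u \<in> A" "a u \<noteq> 0" for a A u
  proof -
    obtain T where T: "finite T" "T \<subseteq> {0<..}" "A = w ` T"
      "E.lincomb a A = (\<lambda>n. ae_class M (\<lambda>x. \<Sum>t\<in>T. a (w t) * v t n x))"
      using lincomb[OF A(1,2)] by blast
    then obtain s where "s \<in> T" "a (w s) \<noteq> 0"
      using A by blast
    then show ?thesis
      unfolding T(4) using nontrivial[OF T(1,2), of s "\<lambda>t. a (w t)"] by simp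
  qed
  have indep: "E.lin_indpt B"
  proof
    assume "E.lin_dep B"
    then obtain a A u where "finite A" "A \<subseteq> B" "E.lincomb a A = \<zero>\<^bsub>L0_seq M\<^esub>"
      "u \<in> A" "a u \<noteq> 0"
      unfolding E.lin_dep_def R by blast
    then show False
      using lincomb_notzero[of A u a] zero_in_S_L[of M 1] by auto
  qed
  define V where "V = E.span B"
  have sub: "VectorSpace.subspace real_field V (L0_seq M)"
    unfolding V_def using B by (rule E.span_is_subspace)
  interpret V: vectorspace real_field "L0_seq M\<lparr>carrier := V\<rparr>"
    by (rule E.subspace_is_vs[OF sub])
  have BV: "B \<subseteq> V"
    unfolding V_def using B by (rule E.in_own_span)
  have "V.basis B"
    \<comment> \<open>Span and linear independence are the same whether computed in the whole space
      or in the subspace \<open>V\<close>.\<close>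
    unfolding V.basis_def
    using E.span_li_not_depend[OF BV E.is_module[OF sub]] indep BV by (simp add: V_def)
  moreover have "B \<approx> (UNIV :: real set)"
  proof -
    have "bij_betw exp (UNIV :: real set) {0<..}"
      by (rule bij_betwI[where g = ln]) auto
    then have "bij_betw (w \<circ> exp) UNIV B"
      unfolding B_def using inj by (auto intro: bij_betw_trans inj_on_imp_bij_betw)
    then show ?thesis
      by (metis eqpoll_def eqpoll_sym)
  qed
  moreover have "L0_seq_topology M closure_of V = topspace (L0_seq_topology M)"
  proof (rule closure_of_L0_seq_eq[OF _ D(2) approx])
    show "V \<subseteq> carrier (L0_seq M)"
      unfolding V_def using B by (rule E.span_is_subset2)
    fix ds assume "ds \<in> lists D"
    then obtain k where "from_nat_into (lists D) k = ds"
      using D(1) from_nat_into_surj[of "lists D"] by auto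
    \<comment> \<open>The shift by one half keeps the parameter positive even for
      \<open>k = 0\<close> without changing its floor.\<close>
    moreover have "nat \<lfloor>real k + 1 / 2\<rfloor> = k"
      by linarith
    ultimately have "L (real k + 1 / 2) = ds"
      by (simp only: L_def)
    then have "\<forall>n<length ds. w (real k + 1 / 2) n = ae_class M (ds ! n)"
      by (simp add: w_def v_def prefixed_exp_def)
    moreover have "w (real k + 1 / 2) \<in> V"
      using BV by (auto simp: B_def add_nonneg_pos)
    ultimately show "\<exists>u\<in>V. \<forall>n<length ds. u n = ae_class M (ds ! n)"
      by blast
  qed
  moreover have "V - {\<zero>\<^bsub>L0_seq M\<^esub>} \<subseteq> S_u M - (\<Union>q\<in>{0<..}. S_L M q)"
  proof
    fix u assume u: "u \<in> V - {\<zero>\<^bsub>L0_seq M\<^esub>}"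
    then obtain a A where A: "finite A" "A \<subseteq> B" "u = E.lincomb a A"
      unfolding V_def E.span_def by blast
    \<comment> \<open>With all coefficients zero, the representatives of \<open>u\<close> would be
      the zero function in every coordinate.\<close>
    have "\<exists>y\<in>A. a y \<noteq> 0"
    proof (rule ccontr)
      assume "\<not> (\<exists>y\<in>A. a y \<noteq> 0)"
      then have "u = \<zero>\<^bsub>L0_seq M\<^esub>"
        using lincomb[OF A(1,2), of a] A(3) by (auto simp: L0_seq_def zero_L0)
      then show False
        using u by blast
    qed
    then show "u \<in> S_u M - (\<Union>q\<in>{0<..}. S_L M q)"
      using lincomb_notzero A by blast
  qed
  ultimately show ?thesis
    unfolding continuum_dense_lineable_def using sub by blast
qed

theorem theorem3p11:
  fixes M :: "'a measure"
  assumes "sigma_finite_measure M"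
    and "emeasure M (space M) = \<infinity>"
    and "\<exists>\<A>\<^sub>1. countable \<A>\<^sub>1 \<and> \<A>\<^sub>1 \<subseteq> sets M \<and>
           (\<forall>E\<in>sets M. emeasure M E < \<infinity> \<longrightarrow>
              (\<forall>\<epsilon>>0::real. \<exists>E\<^sub>0\<in>\<A>\<^sub>1. emeasure M ((E - E\<^sub>0) \<union> (E\<^sub>0 - E)) < ennreal \<epsilon>))"
  shows "continuum_dense_lineable (L0_seq M) (L0_seq_topology M) (S_u M - (\<Union>q\<in>{0<..}. S_L M q))
    \<and> continuum_dense_lineable (L0_seq M) (L0_seq_topology M) (S_p M - (\<Union>q\<in>{0<..}. S_L M q))
    \<and> continuum_dense_lineable (L0_seq M) (L0_seq_topology M) (S_m M - (\<Union>q\<in>{0<..}. S_L M q))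
    \<and> continuum_dense_lineable (L0_seq M) (L0_seq_topology M) (S_au M - (\<Union>q\<in>{0<..}. S_L M q))"
proof -
  obtain \<A> where \<A>: "countable \<A>" "\<A> \<subseteq> sets M"
    and dense: "\<And>E \<epsilon>. E \<in> sets M \<Longrightarrow> emeasure M E < \<infinity> \<Longrightarrow> \<epsilon> > (0::real) \<Longrightarrow>
       \<exists>E\<^sub>0\<in>\<A>. emeasure M ((E - E\<^sub>0) \<union> (E\<^sub>0 - E)) < ennreal \<epsilon>"
    using assms(3) by blast
  have "continuum_dense_lineable (L0_seq M) (L0_seq_topology M) (S_u M - (\<Union>q\<in>{0<..}. S_L M q))"
  \<comment> \<open>Step functions over the given countable family serve as the countable dense
    set.\<close>
  proof (rule continuum_dense_lineable_S_u[OF assms(2), where D = "step_fun ` lists (UNIV \<times> \<A>)"])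
    show "countable (step_fun ` lists (UNIV \<times> \<A>))"
      using \<A>(1) by auto
    show "step_fun ` lists (UNIV \<times> \<A>) \<subseteq> borel_measurable M"
      using \<A>(2) lists_mono[of "UNIV \<times> \<A>" "UNIV \<times> sets M"]
      by (auto intro!: borel_measurable_step_fun)
  qed (use approx_step_fun[OF dense \<A>(2)] in blast)
  \<comment> \<open>The same subspace works for the other three sets, as each of \<open>S_p\<close>,
    \<open>S_m\<close> and \<open>S_au\<close> contains \<open>S_u\<close>.\<close>
  then show ?thesis
    by (meson Diff_mono S_u_subset_S_au S_u_subset_S_m S_u_subset_S_p
        continuum_dense_lineable_mono order_refl)
qed

end
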